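(* Let $f:\mathbb B\to\overline{\mathbb H}^+$ be a slice regular function such that $f(q)=o(|q+1|)$ as $q\to-1$ (with $q\in\mathbb B$). Then $f\equiv0$.
   Context: $\mathbb H$ is the algebra of quaternions, $\mathbb B=\{q\in\mathbb H:|q|<1\}$, $\overline{\mathbb H}^+=\{q\in\mathbb H:\mathrm{Re}(q)\geq0\}$, and $\mathbb S=\{q\in\mathbb H:q^2=-1\}$. For $I\in\mathbb S$, $\mathbb C_I=\mathbb R\oplus I\mathbb R$. A function $f$ on a domain $\Omega\subseteq\mathbb H$ is slice regular if for every $I\in\mathbb S$ its restriction $f_I$ to $\Omega\cap\mathbb C_I$ has continuous partial derivatives and satisfies $\frac12\left(\frac{\partial}{\partial x}+I\frac{\partial}{\partial y}\right)f_I(x+yI)=0$. *)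

theory Defs
  imports "HOL-Analysis.Analysis" "HOL-Library.Landau_Symbols"
begin

section \<open>The normed division algebra of quaternions\<close>

datatype quat = Quat (qRe: real) (qIm1: real) (qIm2: real) (qIm3: real)

lemma quat_eqI [intro?]:
  "qRe p = qRe q \<Longrightarrow> qIm1 p = qIm1 q \<Longrightarrow> qIm2 p = qIm2 q \<Longrightarrow> qIm3 p = qIm3 q \<Longrightarrow> p = q"
  by (rule quat.expand) simp

lemma quat_eq_iff:
  "p = q \<longleftrightarrow> qRe p = qRe q \<and> qIm1 p = qIm1 q \<and> qIm2 p = qIm2 q \<and> qIm3 p = qIm3 q"
  by (auto intro: quat_eqI)

instantiation quat :: real_vector
begin

definition "0 = Quat 0 0 0 0"
definition "- q = Quat (- qRe q) (- qIm1 q) (- qIm2 q) (- qIm3 q)" for q :: quat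
definition
  "p + q = Quat (qRe p + qRe q) (qIm1 p + qIm1 q) (qIm2 p + qIm2 q) (qIm3 p + qIm3 q)"
  for p q :: quat
definition
  "p - q = Quat (qRe p - qRe q) (qIm1 p - qIm1 q) (qIm2 p - qIm2 q) (qIm3 p - qIm3 q)"
  for p q :: quat
definition "r *\<^sub>R q = Quat (r * qRe q) (r * qIm1 q) (r * qIm2 q) (r * qIm3 q)" for q :: quat

instance
  by standard
    (simp_all add: quat_eq_iff zero_quat_def uminus_quat_def plus_quat_def minus_quat_def
      scaleR_quat_def algebra_simps)

end

lemma quat_zero_sel [simp]: "qRe 0 = 0" "qIm1 0 = 0" "qIm2 0 = 0" "qIm3 0 = 0"
  by (simp_all add: zero_quat_def)

lemma quat_uminus_sel [simp]:
  "qRe (- q) = - qRe q" "qIm1 (- q) = - qIm1 q" "qIm2 (- q) = - qIm2 q" "qIm3 (- q) = - qIm3 q"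
  by (simp_all add: uminus_quat_def)

lemma quat_add_sel [simp]:
  "qRe (p + q) = qRe p + qRe q" "qIm1 (p + q) = qIm1 p + qIm1 q"
  "qIm2 (p + q) = qIm2 p + qIm2 q" "qIm3 (p + q) = qIm3 p + qIm3 q"
  by (simp_all add: plus_quat_def)

lemma quat_diff_sel [simp]:
  "qRe (p - q) = qRe p - qRe q" "qIm1 (p - q) = qIm1 p - qIm1 q"
  "qIm2 (p - q) = qIm2 p - qIm2 q" "qIm3 (p - q) = qIm3 p - qIm3 q"
  by (simp_all add: minus_quat_def)

lemma quat_scaleR_sel [simp]:
  "qRe (r *\<^sub>R q) = r * qRe q" "qIm1 (r *\<^sub>R q) = r * qIm1 q"
  "qIm2 (r *\<^sub>R q) = r * qIm2 q" "qIm3 (r *\<^sub>R q) = r * qIm3 q"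
  by (simp_all add: scaleR_quat_def)

instantiation quat :: real_inner
begin

definition "p \<bullet> q = qRe p * qRe q + qIm1 p * qIm1 q + qIm2 p * qIm2 q + qIm3 p * qIm3 q"
  for p q :: quat
definition "norm q = sqrt ((qRe q)\<^sup>2 + (qIm1 q)\<^sup>2 + (qIm2 q)\<^sup>2 + (qIm3 q)\<^sup>2)" for q :: quat
definition "sgn q = q /\<^sub>R norm q" for q :: quat
definition "dist p q = norm (p - q)" for p q :: quat
definition [code del]:
  "(uniformity :: (quat \<times> quat) filter) = (INF e\<in>{0<..}. principal {(x, y). dist x y < e})"
definition [code del]:
  "open U \<longleftrightarrow> (\<forall>x\<in>U. eventually (\<lambda>(x', y). x' = x \<longrightarrow> y \<in> U) uniformity)" for U :: "quat set"

instance
proof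
  fix p q s :: quat and r :: real and U :: "quat set"
  show "p \<bullet> q = q \<bullet> p" "(p + q) \<bullet> s = p \<bullet> s + q \<bullet> s" "r *\<^sub>R p \<bullet> q = r * (p \<bullet> q)"
    by (simp_all add: inner_quat_def algebra_simps)
  show "0 \<le> p \<bullet> p"
    by (simp add: inner_quat_def)
  show "p \<bullet> p = 0 \<longleftrightarrow> p = 0"
    by (auto simp: inner_quat_def quat_eq_iff add_nonneg_eq_0_iff)
  show "norm p = sqrt (p \<bullet> p)"
    by (simp add: norm_quat_def inner_quat_def power2_eq_square)
  show "sgn p = p /\<^sub>R norm p" "dist p q = norm (p - q)"
    by (simp_all add: sgn_quat_def dist_quat_def)
qed (rule uniformity_quat_def open_quat_def)+

end

instantiation quat :: real_normed_div_algebra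
begin

definition "1 = Quat 1 0 0 0"
definition
  "p * q = Quat
    (qRe p * qRe q - qIm1 p * qIm1 q - qIm2 p * qIm2 q - qIm3 p * qIm3 q)
    (qRe p * qIm1 q + qIm1 p * qRe q + qIm2 p * qIm3 q - qIm3 p * qIm2 q)
    (qRe p * qIm2 q - qIm1 p * qIm3 q + qIm2 p * qRe q + qIm3 p * qIm1 q)
    (qRe p * qIm3 q + qIm1 p * qIm2 q - qIm2 p * qIm1 q + qIm3 p * qRe q)"
  for p q :: quat
definition
  "inverse q = Quat (qRe q) (- qIm1 q) (- qIm2 q) (- qIm3 q) /\<^sub>R
    ((qRe q)\<^sup>2 + (qIm1 q)\<^sup>2 + (qIm2 q)\<^sup>2 + (qIm3 q)\<^sup>2)" for q :: quat
definition "p div q = p * inverse q" for p q :: quat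

instance
proof
  fix p q s :: quat and r :: real
  show "p * q * s = p * (q * s)" "(p + q) * s = p * s + q * s" "p * (q + s) = p * q + p * s"
    "r *\<^sub>R p * q = r *\<^sub>R (p * q)" "p * r *\<^sub>R q = r *\<^sub>R (p * q)"
    by (simp_all add: quat_eq_iff times_quat_def algebra_simps)
  show "1 * p = p" "p * 1 = p" "(0 :: quat) \<noteq> 1"
    by (simp_all add: quat_eq_iff times_quat_def one_quat_def)
  show "p div q = p * inverse q" by (rule divide_quat_def)
  show "inverse (0 :: quat) = 0"
    by (simp add: inverse_quat_def)
  show "norm (p * q) = norm p * norm q"
    unfolding norm_quat_def real_sqrt_mult [symmetric] times_quat_def
    by (simp add: power2_eq_square algebra_simps)
  {
    assume "p \<noteq> 0"
    then have *: "(qRe p)\<^sup>2 + (qIm1 p)\<^sup>2 + (qIm2 p)\<^sup>2 + (qIm3 p)\<^sup>2 \<noteq> 0"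
      by (auto simp: quat_eq_iff add_nonneg_eq_0_iff)
    show "inverse p * p = 1" "p * inverse p = 1"
      using * by (simp_all add: inverse_quat_def times_quat_def one_quat_def quat_eq_iff
          divide_simps) (simp_all add: power2_eq_square algebra_simps)
  }
qed

end

lemma quat_one_sel [simp]: "qRe 1 = 1" "qIm1 1 = 0" "qIm2 1 = 0" "qIm3 1 = 0"
  by (simp_all add: one_quat_def)

lemma quat_of_real: "of_real x = Quat x 0 0 0"
  by (simp add: of_real_def quat_eq_iff)

section \<open>Slice regular functions\<close>

definition imag_units :: "quat set" where
  "imag_units = {q. q\<^sup>2 = - 1}"

text \<open>
  The slice of \<open>\<Omega>\<close> in direction \<open>I\<close> is described in the real coordinates \<open>(x, y)\<close> of
  \<open>x + y I\<close>. Since \<open>\<Omega>\<close> is open, so is the coordinate domain \<open>D\<close>; hence the partial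
  derivatives taken at points of \<open>D\<close> depend only on the values of \<open>f\<close> on \<open>\<Omega>\<close>.
\<close>

definition slice_regular_on :: "(quat \<Rightarrow> quat) \<Rightarrow> quat set \<Rightarrow> bool"
    (infixl "slice'_regular'_on" 50) where
  "f slice_regular_on \<Omega> \<longleftrightarrow>
    open \<Omega> \<and> connected \<Omega> \<and>
    (\<forall>I\<in>imag_units.
      let D = {(x, y). of_real x + of_real y * I \<in> \<Omega>} in
      \<exists>fx fy :: real \<times> real \<Rightarrow> quat.
        continuous_on D fx \<and> continuous_on D fy \<and>
        (\<forall>(x, y)\<in>D.
          ((\<lambda>t. f (of_real t + of_real y * I)) has_vector_derivative fx (x, y)) (at x) \<and>
          ((\<lambda>t. f (of_real x + of_real t * I)) has_vector_derivative fy (x, y)) (at y) \<and>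
          (1 / 2) *\<^sub>R (fx (x, y) + I * fy (x, y)) = 0))"

end

theory Submission
  imports Defs "HOL-Complex_Analysis.Conformal_Mappings"
begin

text \<open>
  On a single slice the theorem is the boundary uniqueness principle for holomorphic functions
  with nonnegative real part, and the task is to pass from quaternions to such functions and back.

  Fix an imaginary unit \<open>I\<close> and a quaternion \<open>c\<close>, and restrict \<open>f\<close> to the slice through \<open>I\<close>.
  Since left multiplication by \<open>I\<close> is skew-symmetric, the equation \<open>f\<^sub>x + I f\<^sub>y = 0\<close> says exactly
  that the real functions \<open>c \<bullet> f\<close> and \<open>(I c) \<bullet> f\<close> satisfy the Cauchy--Riemann equations, so
  they are the real and imaginary part of a holomorphic function on the disc
  (\<open>slice_component_holomorphic\<close>).

  For \<open>c = 1\<close> the real part of this function is \<open>Re f \<ge> 0\<close>. The Schwarz lemma, applied after a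
  Cayley transform to \<open>F\<close> with \<open>Re F \<ge> 0\<close>, gives
  \<open>\<bar>F z - F 0\<bar> \<le> \<bar>z\<bar> \<bar>F z + cnj (F 0)\<bar>\<close>. Thus \<open>\<bar>F z\<bar> (1 + \<bar>z\<bar>) \<ge> \<bar>F 0\<bar> (1 - \<bar>z\<bar>)\<close>, so decay
  faster than \<open>1 - r\<close> at the points \<open>-r\<close> forces \<open>F 0 = 0\<close>, and then the same inequality reads
  \<open>\<bar>F z\<bar> \<le> \<bar>z\<bar> \<bar>F z\<bar>\<close>, whence \<open>F = 0\<close>.

  So on each slice the component of \<open>f\<close> in the plane of that slice vanishes. A real point lies on
  all slices, and hence all components of \<open>f\<close> vanish there: \<open>f = 0\<close> on the real diameter.
  By the identity theorem the holomorphic functions belonging to every other \<open>c\<close> are then zero too,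
  and the slices cover the ball.
\<close>

section \<open>Slices of the quaternions\<close>

lemma imag_unit_Re: "qRe I = 0" and imag_unit_norm: "norm I = 1" if "I \<in> imag_units"
proof -
  have sq: "I * I = - 1"
    using that by (simp add: imag_units_def power2_eq_square)
  have "norm I * norm I = 1"
    by (metis norm_mult norm_minus_cancel norm_one sq)
  then have n: "norm I = 1"
    by (metis abs_norm_cancel abs_square_eq_1 power2_eq_square)
  have "(qRe I)\<^sup>2 + (qIm1 I)\<^sup>2 + (qIm2 I)\<^sup>2 + (qIm3 I)\<^sup>2 = 1"
    using n by (simp add: norm_quat_def)
  moreover have "(qRe I)\<^sup>2 - (qIm1 I)\<^sup>2 - (qIm2 I)\<^sup>2 - (qIm3 I)\<^sup>2 = - 1"
    using arg_cong[OF sq, of qRe] by (simp add: times_quat_def power2_eq_square)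
  ultimately have "(qRe I)\<^sup>2 = 0"
    by linarith
  then show "qRe I = 0" by simp
  show "norm I = 1" by (rule n)
qed

lemma imag_unitI: "I \<in> imag_units" if "qRe I = 0" "norm I = 1"
  using that
  by (simp add: imag_units_def power2_eq_square quat_eq_iff times_quat_def norm_quat_def)

lemma inner_imag_unit_mult_left:
  "c \<bullet> (I * q) = - ((I * c) \<bullet> q)" if "I \<in> imag_units" for c q :: quat
  using imag_unit_Re[OF that] by (simp add: inner_quat_def times_quat_def algebra_simps)

lemma imag_unit_mult_self: "I * (I * q) = - q" if "I \<in> imag_units" for q :: quat
  using that by (simp add: imag_units_def power2_eq_square flip: mult.assoc)

definition slice_point :: "quat \<Rightarrow> complex \<Rightarrow> quat" where
  "slice_point I z = of_real (Re z) + of_real (Im z) * I"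

lemma norm_slice_point: "norm (slice_point I z) = norm z" if "I \<in> imag_units"
proof -
  have "(qIm1 I)\<^sup>2 + (qIm2 I)\<^sup>2 + (qIm3 I)\<^sup>2 = 1"
    using imag_unit_Re[OF that] imag_unit_norm[OF that] by (simp add: norm_quat_def)
  then have "(Im z * qIm1 I)\<^sup>2 + (Im z * qIm2 I)\<^sup>2 + (Im z * qIm3 I)\<^sup>2 = (Im z)\<^sup>2"
    by (simp add: power_mult_distrib flip: distrib_left)
  then show ?thesis
    using imag_unit_Re[OF that]
    by (simp add: slice_point_def norm_quat_def cmod_def quat_of_real times_quat_def add.assoc)
qed

lemma slice_point_in_ball: "slice_point I z \<in> ball 0 r \<longleftrightarrow> z \<in> ball 0 r" if "I \<in> imag_units"
  using norm_slice_point[OF that] by simp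

lemma continuous_on_slice_point [continuous_intros]: "continuous_on A (slice_point I)"
  unfolding slice_point_def by (intro continuous_intros)

lemma slice_point_of_real [simp]: "slice_point I (of_real x) = of_real x"
  by (simp add: slice_point_def)

lemma slice_point_surj: "\<exists>I\<in>imag_units. \<exists>z. q = slice_point I z"
proof (cases "q = of_real (qRe q)")
  case True
  have "Quat 0 1 0 0 \<in> imag_units"
    by (rule imag_unitI) (simp_all add: norm_quat_def)
  then show ?thesis
    using True slice_point_of_real by metis
next
  case False
  define v where "v = q - of_real (qRe q)"
  have v: "v \<noteq> 0" "qRe v = 0"
    using False by (simp_all add: v_def quat_of_real)
  have "v /\<^sub>R norm v \<in> imag_units"
    using v by (intro imag_unitI) simp_all
  moreover have "q = slice_point (v /\<^sub>R norm v) (Complex (qRe q) (norm v))"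
  proof -
    have "of_real (norm v) * (v /\<^sub>R norm v) = v"
      using v(1) by (simp flip: scaleR_conv_of_real)
    then show ?thesis by (simp add: slice_point_def v_def)
  qed
  ultimately show ?thesis by blast
qed

section \<open>Holomorphic components of a slice regular function\<close>

text \<open>
  For \<open>c = 1\<close> this is the projection of \<open>f\<close> to the plane spanned by \<open>1\<close> and \<open>I\<close>, identified with
  \<open>\<complex>\<close> by \<open>I \<mapsto> \<i>\<close>. Letting \<open>c\<close> range over all quaternions makes it unnecessary to choose a second
  imaginary unit orthogonal to \<open>I\<close> and to split \<open>f\<close> into two complex-valued functions.
\<close>

definition slice_component :: "quat \<Rightarrow> quat \<Rightarrow> (quat \<Rightarrow> quat) \<Rightarrow> complex \<Rightarrow> complex" where
  "slice_component c I f z = Complex (c \<bullet> f (slice_point I z)) ((I * c) \<bullet> f (slice_point I z))"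

text \<open>
  Continuity of the partial derivatives upgrades them to a total derivative. This needs a
  product neighbourhood, so it is done on a small rectangle around each point.
\<close>

lemma slice_regular_on_has_derivative:
  assumes "f slice_regular_on \<Omega>" and I: "I \<in> imag_units" and z: "slice_point I z \<in> \<Omega>"
  obtains a b where "((\<lambda>w. f (slice_point I w)) has_derivative (\<lambda>h. Re h *\<^sub>R a + Im h *\<^sub>R b)) (at z)"
    and "a + I * b = 0"
proof -
  define D where "D = {(x, y). of_real x + of_real y * I \<in> \<Omega>}"
  define g where "g = (\<lambda>x y. f (of_real x + of_real y * I))"
  from assms(1) I obtain fx fy :: "real \<times> real \<Rightarrow> quat" where
    cont: "continuous_on D fy" and
    part: "\<And>x y. (x, y) \<in> D \<Longrightarrow>
       ((\<lambda>t. g t y) has_vector_derivative fx (x, y)) (at x) \<and>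
       ((\<lambda>t. g x t) has_vector_derivative fy (x, y)) (at y) \<and>
       (1 / 2) *\<^sub>R (fx (x, y) + I * fy (x, y)) = 0"
    unfolding slice_regular_on_def Let_def D_def g_def by fast
  have "open \<Omega>"
    using assms(1) by (simp add: slice_regular_on_def)
  have "D = (\<lambda>p. of_real (fst p) + of_real (snd p) * I) -` \<Omega>"
    by (auto simp: D_def)
  then have "open D"
    using \<open>open \<Omega>\<close> by (auto intro!: open_vimage continuous_intros)
  moreover have zD: "(Re z, Im z) \<in> D"
    using z by (simp add: D_def slice_point_def)
  ultimately obtain A B where AB: "open A" "open B" "Re z \<in> A" "Im z \<in> B" "A \<times> B \<subseteq> D"
    by (metis open_prod_elim mem_Sigma_iff)
  from AB obtain e where e: "e > 0" "ball (Im z) e \<subseteq> B"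
    by (meson open_contains_ball)
  define Y where "Y = ball (Im z) e"
  have Y: "open Y" "convex Y" "Im z \<in> Y" and AY: "A \<times> Y \<subseteq> D" "open (A \<times> Y)"
    using e AB by (auto simp: Y_def intro: open_Times)
  have "((\<lambda>(x, y). g x y) has_derivative
      (\<lambda>(s, t). s *\<^sub>R fx (Re z, Im z) + blinfun_scaleR_left (fy (Re z, Im z)) t))
      (at (Re z, Im z) within A \<times> Y)"
  proof (rule has_derivative_partialsI)
    show "((\<lambda>x. g x (Im z)) has_derivative (\<lambda>s. s *\<^sub>R fx (Re z, Im z))) (at (Re z) within A)"
      using part[OF zD] by (auto simp: has_vector_derivative_def intro: has_derivative_at_withinI)
    show "((\<lambda>y. g x y) has_derivative blinfun_scaleR_left (fy (x, y))) (at y within Y)"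
      if "x \<in> A" "y \<in> Y" for x y
    proof -
      have "(x, y) \<in> D" using that AY by auto
      from part[OF this] show ?thesis
        by (auto simp: has_vector_derivative_def intro: has_derivative_at_withinI)
    qed
    have "continuous_on (A \<times> Y) (\<lambda>p. blinfun_scaleR_left (fy p))"
      by (intro bounded_linear.continuous_on[OF bounded_linear_blinfun_scaleR_left]
          continuous_on_subset[OF cont] AY)
    then show "continuous (at (Re z, Im z) within A \<times> Y)
        (\<lambda>(x, y). blinfun_scaleR_left (fy (x, y)))"
      using AB Y by (auto simp: continuous_on_eq_continuous_within case_prod_beta')
  qed (use Y in auto)
  then have "((\<lambda>(x, y). g x y) has_derivative
      (\<lambda>(s, t). s *\<^sub>R fx (Re z, Im z) + t *\<^sub>R fy (Re z, Im z))) (at (Re z, Im z))"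
    using at_within_open[of "(Re z, Im z)" "A \<times> Y"] AB(3) Y(3) AY(2) by simp
  moreover have "((\<lambda>w. (Re w, Im w)) has_derivative (\<lambda>h. (Re h, Im h))) (at z)"
    by (intro bounded_linear_imp_has_derivative bounded_linear_Pair bounded_linear_Re
        bounded_linear_Im)
  ultimately have "((\<lambda>(x, y). g x y) \<circ> (\<lambda>w. (Re w, Im w)) has_derivative
      (\<lambda>(s, t). s *\<^sub>R fx (Re z, Im z) + t *\<^sub>R fy (Re z, Im z)) \<circ> (\<lambda>h. (Re h, Im h))) (at z)"
    by (intro diff_chain_at) simp_all
  then have "((\<lambda>w. f (slice_point I w)) has_derivative
      (\<lambda>h. Re h *\<^sub>R fx (Re z, Im z) + Im h *\<^sub>R fy (Re z, Im z))) (at z)"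
    by (simp add: o_def g_def slice_point_def)
  with part[OF zD] show ?thesis
    by (intro that[of "fx (Re z, Im z)" "fy (Re z, Im z)"]) auto
qed

text \<open>
  With \<open>f\<^sub>x = - I f\<^sub>y\<close>, skew-symmetry gives \<open>c \<bullet> f\<^sub>x = (I c) \<bullet> f\<^sub>y\<close> and, replacing \<open>c\<close> by \<open>I c\<close>,
  \<open>(I c) \<bullet> f\<^sub>x = - (c \<bullet> f\<^sub>y)\<close>.
\<close>

lemma slice_component_holomorphic:
  assumes "f slice_regular_on \<Omega>" and I: "I \<in> imag_units"
  shows "slice_component c I f holomorphic_on {z. slice_point I z \<in> \<Omega>}"
proof -
  have "slice_component c I f field_differentiable (at z)" if "slice_point I z \<in> \<Omega>" for z
  proof -
    from slice_regular_on_has_derivative[OF assms that] obtain a b where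
      der: "((\<lambda>w. f (slice_point I w)) has_derivative (\<lambda>h. Re h *\<^sub>R a + Im h *\<^sub>R b)) (at z)"
      and "a + I * b = 0" .
    then have a: "a = - (I * b)"
      by (simp add: eq_neg_iff_add_eq_0)
    have lin: "bounded_linear (\<lambda>q. complex_of_real (c \<bullet> q) + \<i> * complex_of_real ((I * c) \<bullet> q))"
      by (intro bounded_linear_add bounded_linear_const_mult
          bounded_linear_compose[OF bounded_linear_of_real] bounded_linear_inner_right)
    have CR: "c \<bullet> a = (I * c) \<bullet> b" "(I * c) \<bullet> a = - (c \<bullet> b)"
      unfolding a by (simp_all add: inner_imag_unit_mult_left[OF I] imag_unit_mult_self[OF I])
    have "((\<lambda>w. complex_of_real (c \<bullet> f (slice_point I w))
             + \<i> * complex_of_real ((I * c) \<bullet> f (slice_point I w))) has_derivative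
        (\<lambda>h. complex_of_real (c \<bullet> (Re h *\<^sub>R a + Im h *\<^sub>R b))
             + \<i> * complex_of_real ((I * c) \<bullet> (Re h *\<^sub>R a + Im h *\<^sub>R b)))) (at z)"
      by (rule bounded_linear.has_derivative[OF lin der])
    also have "(\<lambda>h. complex_of_real (c \<bullet> (Re h *\<^sub>R a + Im h *\<^sub>R b))
             + \<i> * complex_of_real ((I * c) \<bullet> (Re h *\<^sub>R a + Im h *\<^sub>R b)))
        = (*) (Complex (c \<bullet> a) ((I * c) \<bullet> a))"
      by (rule ext) (simp add: complex_eq_iff inner_add_right CR)
    finally show ?thesis
      unfolding field_differentiable_def has_field_derivative_def slice_component_def[abs_def]
        Complex_eq by blast
  qed
  then show ?thesis
    by (auto simp: holomorphic_on_def intro: field_differentiable_at_within)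
qed

lemma slice_component_holomorphic_ball:
  assumes "f slice_regular_on ball 0 r" and "I \<in> imag_units"
  shows "slice_component c I f holomorphic_on ball 0 r"
  using slice_component_holomorphic[OF assms, of c] unfolding slice_point_in_ball[OF assms(2)]
  by (simp only: Collect_mem_eq)

lemma norm_slice_component_le:
  assumes "I \<in> imag_units"
  shows "norm (slice_component c I f z) \<le> 2 * norm c * norm (f (slice_point I z))"
proof -
  have "norm (slice_component c I f z)
      \<le> \<bar>c \<bullet> f (slice_point I z)\<bar> + \<bar>(I * c) \<bullet> f (slice_point I z)\<bar>"
    unfolding slice_component_def by (metis cmod_le complex.sel)
  also have "\<dots> \<le> norm c * norm (f (slice_point I z)) + norm (I * c) * norm (f (slice_point I z))"
    by (intro add_mono Cauchy_Schwarz_ineq2)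
  finally show ?thesis
    using imag_unit_norm[OF assms] by (simp add: norm_mult)
qed

section \<open>Holomorphic functions with nonnegative real part\<close>

text \<open>
  The map \<open>w \<mapsto> (w - a) / (w + cnj a)\<close> sends the right half-plane into the unit disc and \<open>a\<close> to
  \<open>0\<close>, so this is the Schwarz lemma for its composition with \<open>F\<close>. To have a strictly positive
  real part everywhere, \<open>F\<close> is first shifted by some \<open>\<delta> > 0\<close>, which then tends to \<open>0\<close>.
\<close>

lemma Schwarz_Re_nonneg:
  fixes F :: "complex \<Rightarrow> complex"
  assumes holo: "F holomorphic_on ball 0 1" and Re: "\<And>z. norm z < 1 \<Longrightarrow> 0 \<le> Re (F z)"
    and z: "norm z < 1"
  shows "norm (F z - F 0) \<le> norm z * norm (F z + cnj (F 0))"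
proof (rule field_le_epsilon)
  fix e :: real assume "e > 0"
  define d where "d = e / 2"
  define a where "a = F 0 + of_real d"
  define \<phi> where "\<phi> = (\<lambda>z. (F z + of_real d - a) / (F z + of_real d + cnj a))"
  have "d > 0" using \<open>e > 0\<close> by (simp add: d_def)
  have den: "F w + of_real d + cnj a \<noteq> 0" if "norm w < 1" for w
  proof -
    have "Re (F w + of_real d + cnj a) > 0"
      using Re[OF that] Re[of 0] \<open>d > 0\<close> by (simp add: a_def)
    then show ?thesis by force
  qed
  have "norm (\<phi> z) \<le> norm z"
  proof (rule Schwarz_Lemma(1))
    show "\<phi> holomorphic_on ball 0 1"
      unfolding \<phi>_def using den by (intro holomorphic_intros holo) auto
    show "\<phi> 0 = 0" by (simp add: \<phi>_def a_def)
    show "norm (\<phi> w) < 1" if "norm w < 1" for w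
    proof -
      define u where "u = F w + of_real d"
      have "0 < Re u * Re a"
        using Re[OF that] Re[of 0] \<open>d > 0\<close> by (intro mult_pos_pos) (simp_all add: u_def a_def)
      moreover have "(norm (u + cnj a))\<^sup>2 - (norm (u - a))\<^sup>2 = 4 * (Re u * Re a)"
        unfolding cmod_power2 by (simp add: power2_eq_square algebra_simps)
      ultimately have "(norm (u - a))\<^sup>2 < (norm (u + cnj a))\<^sup>2"
        by linarith
      then have "norm (u - a) < norm (u + cnj a)"
        by (rule power2_less_imp_less) simp
      then show ?thesis
        using den[OF that] by (simp add: \<phi>_def u_def norm_divide)
    qed
  qed (rule z)
  then have "norm (F z - F 0) \<le> norm z * norm (F z + cnj (F 0) + of_real e)"
    using den[OF z] by (simp add: \<phi>_def a_def norm_divide divide_le_eq d_def algebra_simps)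
  also have "\<dots> \<le> norm z * (norm (F z + cnj (F 0)) + e)"
    using \<open>e > 0\<close> norm_triangle_ineq[of "F z + cnj (F 0)" "of_real e"]
    by (intro mult_left_mono) auto
  also have "\<dots> \<le> norm z * norm (F z + cnj (F 0)) + e"
    using z \<open>e > 0\<close> by (simp add: distrib_left mult_left_le_one_le)
  finally show "norm (F z - F 0) \<le> norm z * norm (F z + cnj (F 0)) + e" .
qed

text \<open>
  A Hopf-type boundary principle at \<open>-1\<close>: by the Schwarz estimate \<open>\<bar>F (-r)\<bar>\<close> is at least
  \<open>\<bar>F 0\<bar> / 2\<close> times the distance \<open>1 - r\<close> to the boundary.
\<close>

lemma Re_nonneg_radial_decay_imp_zero:
  fixes F :: "complex \<Rightarrow> complex"
  assumes holo: "F holomorphic_on ball 0 1" and Re: "\<And>z. norm z < 1 \<Longrightarrow> 0 \<le> Re (F z)"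
    and decay: "\<And>e. e > 0 \<Longrightarrow> \<exists>r. 0 \<le> r \<and> r < 1 \<and> norm (F (of_real (- r))) \<le> e * (1 - r)"
    and z: "norm z < 1"
  shows "F z = 0"
proof -
  have Schwarz: "norm (F w - F 0) \<le> norm w * norm (F w + cnj (F 0))" if "norm w < 1" for w
    using holo Re that by (rule Schwarz_Re_nonneg)
  have "norm (F 0) \<le> 0 + e" if "e > 0" for e
  proof -
    obtain r where r: "0 \<le> r" "r < 1" and Fr: "norm (F (of_real (- r))) \<le> e / 2 * (1 - r)"
      using decay[of "e / 2"] \<open>e > 0\<close> by auto
    define w where "w = F (of_real (- r))"
    have "norm (F 0) - norm w \<le> norm (w - F 0)"
      by (metis norm_minus_commute norm_triangle_ineq2)
    also have "\<dots> \<le> r * norm (w + cnj (F 0))"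
      using Schwarz[of "of_real (- r)"] r by (simp add: w_def)
    also have "\<dots> \<le> r * (norm w + norm (F 0))"
      using norm_triangle_ineq[of w "cnj (F 0)"] r by (intro mult_left_mono) auto
    finally have "norm (F 0) * (1 - r) \<le> norm w * (1 + r)"
      by (simp add: algebra_simps)
    also have "\<dots> \<le> norm w * 2"
      using r by (intro mult_left_mono) auto
    also have "\<dots> \<le> e * (1 - r)"
      using Fr by (simp add: w_def)
    finally show ?thesis
      using r by simp
  qed
  then have "F 0 = 0"
    using field_le_epsilon[of "norm (F 0)" 0] by auto
  then have "norm (F z) * (1 - norm z) \<le> 0"
    using Schwarz[OF z] by (simp add: algebra_simps)
  then show ?thesis
    using z by (simp add: mult_le_0_iff)
qed

section \<open>The rigidity theorem\<close>

lemma smallo_at_minus_one_real: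
  fixes f :: "quat \<Rightarrow> quat"
  assumes "(\<lambda>q. norm (f q)) \<in> o[at (- 1) within ball 0 1](\<lambda>q. norm (q + 1))" and "e > 0"
  obtains r where "0 \<le> r" "r < 1" "norm (f (of_real (- r))) \<le> e * (1 - r)"
proof -
  have "\<forall>\<^sub>F q in at (- 1) within ball 0 1. norm (f q) \<le> e * norm (q + 1)"
    using landau_o.smallD[OF assms] by simp
  then obtain d where d: "d > 0"
    "\<And>q. q \<in> ball 0 1 \<Longrightarrow> q \<noteq> - 1 \<Longrightarrow> dist q (- 1) < d \<Longrightarrow> norm (f q) \<le> e * norm (q + 1)"
    unfolding eventually_at by blast
  define r where "r = 1 - min 1 (d / 2)"
  have r: "0 \<le> r" "r < 1" "1 - r < d"
    using d(1) by (auto simp: r_def min_def)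
  have shift: "(of_real (- r) :: quat) + 1 = of_real (1 - r)"
    by simp
  then have n: "norm ((of_real (- r) :: quat) + 1) = 1 - r"
    using r by (metis abs_of_nonneg diff_ge_0_iff_ge less_imp_le norm_of_real)
  have "norm (f (of_real (- r))) \<le> e * norm ((of_real (- r) :: quat) + 1)"
  proof (rule d(2))
    show "of_real (- r) \<in> ball (0 :: quat) 1"
      using r by simp
    show "(of_real (- r) :: quat) \<noteq> - 1"
      using n r by force
    show "dist (of_real (- r) :: quat) (- 1) < d"
      using n r by (simp add: dist_norm)
  qed
  with n r that show ?thesis by simp
qed

text \<open>
  The real diameter lies in every slice and accumulates there, so the identity theorem applies to
  all components on that slice; taking \<open>c\<close> to be the value \<open>f q\<close> itself turns the vanishing of
  \<open>c \<bullet> f q\<close> into \<open>f q = 0\<close>.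
\<close>

lemma slice_regular_on_ball_eq_zero_if_real:
  assumes reg: "f slice_regular_on ball 0 1"
    and real: "\<And>x. \<bar>x\<bar> < 1 \<Longrightarrow> f (of_real x) = 0"
    and q: "q \<in> ball 0 1"
  shows "f q = 0"
proof -
  obtain I z where I: "I \<in> imag_units" and qz: "q = slice_point I z"
    using slice_point_surj by blast
  have z: "z \<in> ball 0 1"
    using q slice_point_in_ball[OF I] by (simp add: qz)
  have lim: "0 islimpt complex_of_real ` {-1<..<1}"
    unfolding islimpt_approachable
  proof (intro allI impI)
    fix e :: real assume "e > 0"
    then show "\<exists>x'\<in>complex_of_real ` {-1<..<1}. x' \<noteq> 0 \<and> dist x' 0 < e"
      by (intro bexI[of _ "of_real (min (1 / 2) (e / 2))"] imageI) (auto simp: min_def)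
  qed
  have "slice_component c I f z = 0" for c
  proof (rule analytic_continuation[OF slice_component_holomorphic_ball[OF reg I]])
    show "0 islimpt complex_of_real ` {-1<..<1}" by (rule lim)
    show "slice_component c I f w = 0" if "w \<in> complex_of_real ` {-1<..<1}" for w
      using that real by (auto simp: slice_component_def zero_complex.code abs_less_iff)
  qed (use z in \<open>auto simp: abs_less_iff\<close>)
  then have "f q \<bullet> f q = 0"
    by (simp add: slice_component_def qz complex_eq_iff)
  then show ?thesis by simp
qed

theorem theorem3:
  fixes f :: "quat \<Rightarrow> quat"
  assumes "f slice_regular_on ball 0 1"
    and "f \<in> ball 0 1 \<rightarrow> {q. 0 \<le> qRe q}"
    and "(\<lambda>q. norm (f q)) \<in> o[at (- 1) within ball 0 1](\<lambda>q. norm (q + 1))"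
  shows "\<forall>q\<in>ball 0 1. f q = 0"
proof -
  have inner_1: "1 \<bullet> q = qRe q" for q :: quat
    by (simp add: inner_quat_def)
  have comp: "slice_component 1 I f z = 0" if I: "I \<in> imag_units" and z: "norm z < 1" for I z
  proof (rule Re_nonneg_radial_decay_imp_zero[OF slice_component_holomorphic_ball[OF assms(1) I] _ _ z])
    show "0 \<le> Re (slice_component 1 I f w)" if "norm w < 1" for w
      using assms(2) that norm_slice_point[OF I, of w]
      by (auto simp: slice_component_def inner_1 Pi_iff)
    fix e :: real assume "e > 0"
    then obtain r where r: "0 \<le> r" "r < 1" "norm (f (of_real (- r))) \<le> e / 2 * (1 - r)"
      using smallo_at_minus_one_real[OF assms(3), of "e / 2"] by auto
    have "norm (slice_component 1 I f (of_real (- r))) \<le> 2 * norm (f (of_real (- r)))"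
      using norm_slice_component_le[OF I, of 1 f "of_real (- r)"] unfolding slice_point_of_real
      by simp
    also have "\<dots> \<le> e * (1 - r)"
      using r(3) by simp
    finally have "norm (slice_component 1 I f (of_real (- r))) \<le> e * (1 - r)" .
    then show "\<exists>r. 0 \<le> r \<and> r < 1 \<and> norm (slice_component 1 I f (of_real (- r))) \<le> e * (1 - r)"
      using r by blast
  qed
  have "f (of_real x) = 0" if "\<bar>x\<bar> < 1" for x
  proof -
    have "qRe (f (of_real x)) = 0 \<and> I \<bullet> f (of_real x) = 0" if "I \<in> imag_units" for I
      using comp[OF that, of "of_real x"] \<open>\<bar>x\<bar> < 1\<close>
      by (simp add: slice_component_def inner_1 complex_eq_iff del: of_real_eq_0_iff)
    \<comment> \<open>As a real point lies on every slice, \<open>I\<close> may now run through a basis of the imaginary part.\<close>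
    moreover have "Quat 0 1 0 0 \<in> imag_units" "Quat 0 0 1 0 \<in> imag_units" "Quat 0 0 0 1 \<in> imag_units"
      by (auto intro!: imag_unitI simp: norm_quat_def)
    ultimately show ?thesis
      by (force simp: inner_quat_def quat_eq_iff)
  qed
  then show ?thesis
    using slice_regular_on_ball_eq_zero_if_real[OF assms(1)] by blast
qed

end
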